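(* For a positive integer $M$ let $\mathcal S_M=\{[ij]\in\mathcal S: 0<j-i<M\}$. Let ${\bf x}=\sum_{J}a_J{\bf x}_J\in\mathcal A$, where $J$ runs over finite sequences of elements of $\mathcal S$, ${\bf x}_J$ is the corresponding word, and $a_J\in\mathbb Z$. If for every positive integer $M$ only finitely many sequences $J$ consisting solely of elements of $\mathcal S_M$ have $a_J\neq0$, then ${\bf x}$ gives a valid (well-defined) Bruhat action on $\mathbb A$, i.e. for each $w\in\widetilde S_n$ only finitely many terms $a_J\,A_w\cdot{\bf x}_J$ are nonzero.
   Context: Fix $n\ge2$. $\widetilde S_n$ is the affine symmetric group (bijections $w$ of $\mathbb Z$ with $w(i+n)=w(i)+n$, $\sum_{i=1}^n w(i)=\sum_{i=1}^n i$), with Coxeter generators $s_0,\dots,s_{n-1}$ and length $\ell$; for $i<j$, $i\not\equiv j\pmod n$, $t_{ij}$ is the element swapping $i+rn$ and $j+rn$ for all $r$. $\mathbb A$ is the affine nilCoxeter algebra with basis $A_w$, $w\in\widetilde S_n$ ($A_i^2=0$, braid relations; $A_w$ is the product along any reduced word). $\mathcal S$ is the set of symbols $[ij]$ with $i<j$ integers, $i\not\equiv j\pmod n$. $\mathcal A$ is the completion of the free algebra on $\mathcal S$ with respect to the filtration by subalgebras generated by $[ij]$ with $|i|,|j|\ge N$; its elements are formal possibly infinite integer combinations of finite words. The Bruhat action: $A_w\cdot[ij]=A_{wt_{ij}}$ if $\ell(wt_{ij})=\ell(w)-1$, and $0$ otherwise, extended multiplicatively to words and linearly. *)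

theory Defs
  imports
    "HOL-Library.Poly_Mapping"
    "HOL-Number_Theory.Cong"
    "HOL-Algebra.Ring"
begin

definition affine_sym :: "nat \<Rightarrow> (int \<Rightarrow> int) set" where
  "affine_sym n = {w. bij w \<and> (\<forall>i. w (i + int n) = w i + int n) \<and>
     (\<Sum>i = 1..int n. w i) = (\<Sum>i = 1..int n. i)}"

definition affine_transp :: "nat \<Rightarrow> int \<Rightarrow> int \<Rightarrow> int \<Rightarrow> int" where
  "affine_transp n i j k =
     (if [k = i] (mod int n) then k + (j - i)
      else if [k = j] (mod int n) then k - (j - i)
      else k)"

lemma affine_transp_swaps:
  assumes "\<not> [i = j] (mod int n)"
  shows "affine_transp n i j (i + r * int n) = j + r * int n"
    and "affine_transp n i j (j + r * int n) = i + r * int n"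
  using assms by (auto simp: affine_transp_def cong_def)

definition cox_gen :: "nat \<Rightarrow> nat \<Rightarrow> int \<Rightarrow> int" where
  "cox_gen n i = affine_transp n (int i) (int i + 1)"

definition cox_prod :: "nat \<Rightarrow> nat list \<Rightarrow> int \<Rightarrow> int" where
  "cox_prod n is = foldr (\<lambda>i u. cox_gen n i \<circ> u) is id"

definition cox_length :: "nat \<Rightarrow> (int \<Rightarrow> int) \<Rightarrow> nat" where
  "cox_length n w = (LEAST k. \<exists>is. set is \<subseteq> {..<n} \<and> length is = k \<and> cox_prod n is = w)"

text \<open>The affine nilCoxeter algebra over the integers on its basis indexed by the affine
  symmetric group, the basis element of \<open>w\<close> being \<open>frag_of w\<close>. On this basis the product of the
  elements of \<open>u\<close> and \<open>v\<close> is the element of \<open>u \<circ> v\<close> if lengths add up, and zero otherwise.\<close>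

definition nilCoxeter :: "nat \<Rightarrow> ((int \<Rightarrow> int) \<Rightarrow>\<^sub>0 int) ring" where
  "nilCoxeter n =
     \<lparr>carrier = {x. Poly_Mapping.keys x \<subseteq> affine_sym n},
      monoid.mult = (\<lambda>x y. frag_extend (\<lambda>u. frag_extend (\<lambda>v.
        if cox_length n (u \<circ> v) = cox_length n u + cox_length n v
        then frag_of (u \<circ> v) else 0) y) x),
      one = frag_of id,
      zero = 0,
      add = (+)\<rparr>"

abbreviation nil_basis :: "(int \<Rightarrow> int) \<Rightarrow> (int \<Rightarrow> int) \<Rightarrow>\<^sub>0 int" where
  "nil_basis w \<equiv> frag_of w"

text \<open>The symbol \<open>[ij]\<close> is the pair \<open>(i, j)\<close>, and a word is the list of its letters.\<close>

definition symbols :: "nat \<Rightarrow> (int \<times> int) set" where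
  "symbols n = {(i, j). i < j \<and> \<not> [i = j] (mod int n)}"

definition short_symbols :: "nat \<Rightarrow> nat \<Rightarrow> (int \<times> int) set" where
  "short_symbols n M = {(i, j) \<in> symbols n. 0 < j - i \<and> j - i < int M}"

text \<open>Elements of the completed free algebra: arbitrary formal integer combinations of words,
  given by their coefficient functions.\<close>

definition formal_sums :: "nat \<Rightarrow> ((int \<times> int) list \<Rightarrow> int) set" where
  "formal_sums n = {a. \<forall>J. a J \<noteq> 0 \<longrightarrow> J \<in> lists (symbols n)}"

definition bruhat_basis :: "nat \<Rightarrow> int \<times> int \<Rightarrow> (int \<Rightarrow> int) \<Rightarrow> (int \<Rightarrow> int) \<Rightarrow>\<^sub>0 int" where
  "bruhat_basis n = (\<lambda>(i, j) w.
     if cox_length n (w \<circ> affine_transp n i j) + 1 = cox_length n w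
     then nil_basis (w \<circ> affine_transp n i j) else 0)"

text \<open>Symbols act from the right, so the letters of a word act from left to right.\<close>

definition bruhat_word ::
    "nat \<Rightarrow> ((int \<Rightarrow> int) \<Rightarrow>\<^sub>0 int) \<Rightarrow> (int \<times> int) list \<Rightarrow> (int \<Rightarrow> int) \<Rightarrow>\<^sub>0 int" where
  "bruhat_word n = foldl (\<lambda>x p. frag_extend (bruhat_basis n p) x)"

definition valid_bruhat_action :: "nat \<Rightarrow> ((int \<times> int) list \<Rightarrow> int) \<Rightarrow> bool" where
  "valid_bruhat_action n a \<longleftrightarrow> (\<forall>w \<in> affine_sym n.
     finite {J \<in> lists (symbols n).
       frag_cmul (a J) (bruhat_word n (nil_basis w) J) \<noteq> \<zero>\<^bsub>nilCoxeter n\<^esub>})"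

end

theory Submission
  imports Defs
begin

text \<open>A simple reflection moves every integer by at most one, so \<open>\<bar>w k - k\<bar> \<le> \<ell>(w)\<close>. If the symbol
  \<open>[ij]\<close> does not kill the basis element of \<open>w\<close>, then \<open>v = w t\<^sub>i\<^sub>j\<close> is shorter than \<open>w\<close> and satisfies
  \<open>v i = w j\<close>, whence \<open>j - i \<le> 2 \<ell>(w)\<close>. Thus only words in \<open>\<S>\<^sub>M\<close> with \<open>M = 2 \<ell>(w) + 1\<close> act on the
  basis element of \<open>w\<close> in a nonzero way. That \<open>\<ell>\<close> is the length of an actual word requires the simple
  reflections to generate the group: sorting a descent of \<open>w\<close> lowers the sum of \<open>(w k - k)\<^sup>2\<close> over
  a period, and the identity is the only element without descents.\<close>

section \<open>Sums over a period\<close>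

lemma periodic_mult:
  fixes f :: "int \<Rightarrow> 'a" and m :: int
  assumes "\<And>k. f (k + m) = f k"
  shows "f (k + r * m) = f k"
proof (induction r rule: int_induct[where k = 0])
  case base
  show ?case by simp
next
  case (step1 r)
  then show ?case using assms[of "k + r * m"] by (simp add: algebra_simps)
next
  case (step2 r)
  then show ?case using assms[of "k + (r - 1) * m"] by (simp add: algebra_simps)
qed

lemma periodic_mod:
  fixes f :: "int \<Rightarrow> 'a" and m :: int
  assumes "\<And>k. f (k + m) = f k"
  shows "f (k mod m) = f k"
  using periodic_mult[of f m "k mod m" "k div m", OF assms] by (simp add: algebra_simps)

lemma shift_commute_mult:
  fixes t :: "int \<Rightarrow> int"
  assumes "\<And>k. t (k + m) = t k + m"
  shows "t (k + r * m) = t k + r * m"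
  using periodic_mult[of "\<lambda>k. t k - k" m k r] assms by (simp add: algebra_simps)

text \<open>Modulo \<open>m\<close>, \<open>t\<close> induces an injection of the window
  \<open>{0..<m}\<close> into itself, hence a permutation, and \<open>f\<close> only sees
  residues.\<close>

lemma sum_periodic_reindex:
  fixes f :: "int \<Rightarrow> 'a :: comm_monoid_add" and t :: "int \<Rightarrow> int"
  assumes m: "m > 0" and f: "\<And>k. f (k + m) = f k"
    and t: "inj t" "\<And>k. t (k + m) = t k + m"
  shows "(\<Sum>k\<in>{0..<m}. f (t k)) = (\<Sum>k\<in>{0..<m}. f k)"
proof -
  have inj: "inj_on (\<lambda>k. t k mod m) {0..<m}"
  proof (rule inj_onI)
    fix k l assume kl: "k \<in> {0..<m}" "l \<in> {0..<m}" "t k mod m = t l mod m"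
    then obtain r where "t k = t l + r * m"
      by (metis mod_eqE mult.commute)
    then have "t k = t (l + r * m)" by (simp add: shift_commute_mult[of t, OF t(2)])
    then have "k = l + r * m" using t(1) by (simp add: inj_eq)
    then have "k mod m = l mod m" by simp
    then show "k = l" using kl by simp
  qed
  have "(\<lambda>k. t k mod m) ` {0..<m} = {0..<m}"
    using m by (intro card_subset_eq) (auto simp: card_image[OF inj])
  then have "(\<Sum>k\<in>{0..<m}. f k) = (\<Sum>k\<in>{0..<m}. f (t k mod m))"
    using sum.reindex[OF inj, of f] by (simp add: comp_def)
  then show ?thesis by (simp add: periodic_mod[of f, OF f])
qed

text \<open>Passes from the window in the definition of \<open>affine_sym\<close> to the one whose
  elements are the residues given by \<open>mod\<close>.\<close>

lemma sum_periodic_from_1: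
  fixes f :: "int \<Rightarrow> 'a :: comm_monoid_add"
  assumes "m > 0" and "\<And>k. f (k + m) = f k"
  shows "(\<Sum>k = 1..m. f k) = (\<Sum>k\<in>{0..<m}. f k)"
proof -
  have "(\<Sum>k = 1..m. f k) = (\<Sum>k\<in>{0..<m}. f (k + 1))"
    by (rule sum.reindex_bij_witness[of _ "\<lambda>k. k + 1" "\<lambda>k. k - 1"]) auto
  also have "\<dots> = (\<Sum>k\<in>{0..<m}. f k)"
    using sum_periodic_reindex[of m f "\<lambda>k. k + 1", OF assms] by simp
  finally show ?thesis .
qed

text \<open>Only the residues of \<open>i\<close> and \<open>j\<close> contribute, and they are
  distinct because \<open>i\<close> and \<open>j\<close> are incongruent.\<close>

lemma sum_periodic_two_classes:
  fixes f :: "int \<Rightarrow> 'a :: comm_monoid_add"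
  assumes m: "m > 0" and f: "\<And>k. f (k + m) = f k" and ij: "\<not> [i = j] (mod m)"
    and z: "\<And>k. \<not> [k = i] (mod m) \<Longrightarrow> \<not> [k = j] (mod m) \<Longrightarrow> f k = 0"
  shows "(\<Sum>k\<in>{0..<m}. f k) = f i + f j"
proof -
  have "(\<Sum>k\<in>{0..<m}. f k) = (\<Sum>k\<in>{i mod m, j mod m}. f k)"
    using m by (intro sum.mono_neutral_right) (auto intro!: z simp: cong_def)
  also have "\<dots> = f i + f j"
    using ij by (simp add: cong_def periodic_mod[of f, OF f])
  finally show ?thesis .
qed

section \<open>Affine transpositions\<close>

lemma affine_transp_shift: "affine_transp n i j (k + int n) = affine_transp n i j k + int n"
  by (simp add: affine_transp_def cong_def)

lemma affine_transp_left: "affine_transp n i j i = j"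
  by (simp add: affine_transp_def)

lemma affine_transp_right: "\<not> [i = j] (mod int n) \<Longrightarrow> affine_transp n i j j = i"
  by (auto simp: affine_transp_def cong_def)

lemma affine_transp_other:
  "\<not> [k = i] (mod int n) \<Longrightarrow> \<not> [k = j] (mod int n) \<Longrightarrow> affine_transp n i j k = k"
  by (simp add: affine_transp_def)

lemma affine_transp_involution:
  assumes ij: "\<not> [i = j] (mod int n)"
  shows "affine_transp n i j (affine_transp n i j k) = k"
proof -
  consider "[k = i] (mod int n)" | "[k = j] (mod int n)"
    | "\<not> [k = i] (mod int n)" "\<not> [k = j] (mod int n)" by blast
  then show ?thesis
  proof cases
    case 1
    then have "[k + (j - i) = j] (mod int n)"
      by (simp add: cong_iff_dvd_diff algebra_simps)
    moreover from this ij have "\<not> [k + (j - i) = i] (mod int n)"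
      by (metis cong_sym cong_trans)
    ultimately show ?thesis using 1 by (simp add: affine_transp_def)
  next
    case 2
    then have "[k - (j - i) = i] (mod int n)"
      by (metis cong_diff cong_refl diff_diff_eq2 add_diff_cancel_left')
    moreover have "\<not> [k = i] (mod int n)" using 2 ij by (metis cong_sym cong_trans)
    ultimately show ?thesis using 2 by (simp add: affine_transp_def)
  next
    case 3
    then show ?thesis by (simp add: affine_transp_other)
  qed
qed

lemma bij_affine_transp: "\<not> [i = j] (mod int n) \<Longrightarrow> bij (affine_transp n i j)"
  by (intro o_bij[where g = "affine_transp n i j"]) (auto simp: affine_transp_involution)

text \<open>Unlike \<open>w\<close> itself, the displacement \<open>w k - k\<close> is periodic, so
  this form of the normalisation is open to reindexing.\<close>

lemma affine_sym_iff:
  assumes "n > 0"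
  shows "w \<in> affine_sym n \<longleftrightarrow> bij w \<and> (\<forall>k. w (k + int n) = w k + int n) \<and>
    (\<Sum>k\<in>{0..<int n}. w k - k) = 0"
proof -
  have "(\<Sum>i = 1..int n. w i) = (\<Sum>i = 1..int n. i) \<longleftrightarrow> (\<Sum>k\<in>{0..<int n}. w k - k) = 0"
    if "\<forall>k. w (k + int n) = w k + int n"
    using sum_periodic_from_1[of "int n" "\<lambda>k. w k - k"] that assms
    by (auto simp: sum_subtractf)
  then show ?thesis unfolding affine_sym_def by auto
qed

text \<open>The displacement of the composite at \<open>k\<close> is that of \<open>w\<close> at
  \<open>?t k\<close> plus that of \<open>?t\<close> at \<open>k\<close>. The first sums to 0 by
  reindexing, the second because \<open>j - i\<close> and \<open>i - j\<close> cancel.\<close>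

lemma affine_sym_comp_transp:
  assumes n: "n > 0" and w: "w \<in> affine_sym n" and ij: "\<not> [i = j] (mod int n)"
  shows "w \<circ> affine_transp n i j \<in> affine_sym n"
proof -
  let ?t = "affine_transp n i j"
  have w': "bij w" "\<And>k. w (k + int n) = w k + int n" "(\<Sum>k\<in>{0..<int n}. w k - k) = 0"
    using w affine_sym_iff[OF n] by auto
  have "(\<Sum>k\<in>{0..<int n}. w (?t k) - k)
      = (\<Sum>k\<in>{0..<int n}. w (?t k) - ?t k) + (\<Sum>k\<in>{0..<int n}. ?t k - k)"
    by (simp flip: sum.distrib)
  also have "(\<Sum>k\<in>{0..<int n}. w (?t k) - ?t k) = 0"
    using sum_periodic_reindex[of "int n" "\<lambda>k. w k - k" ?t] n w'
      bij_affine_transp[OF ij] affine_transp_shift by (simp add: bij_is_inj)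
  also have "(\<Sum>k\<in>{0..<int n}. ?t k - k) = 0"
    using sum_periodic_two_classes[of "int n" "\<lambda>k. ?t k - k" i j] n ij
    by (simp add: affine_transp_shift affine_transp_left affine_transp_right affine_transp_other)
  finally show ?thesis
    using w' bij_affine_transp[OF ij]
    by (simp add: affine_sym_iff[OF n] affine_transp_shift bij_comp)
qed

section \<open>Generation by simple reflections\<close>

text \<open>A termination measure for sorting that does not refer to \<open>cox_length\<close>,
  which is meaningful only once generation is known.\<close>

definition sq_displacement :: "nat \<Rightarrow> (int \<Rightarrow> int) \<Rightarrow> int" where
  "sq_displacement n w = (\<Sum>k\<in>{0..<int n}. (w k - k)\<^sup>2)"

lemma not_cong_Suc: "n \<ge> 2 \<Longrightarrow> \<not> [i = i + 1] (mod int n)"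
  by (simp add: cong_iff_dvd_diff)

lemma sq_displacement_comp_cox_gen:
  assumes n: "n \<ge> 2" and w: "\<And>k. w (k + int n) = w k + int n"
  shows "sq_displacement n (w \<circ> cox_gen n i) =
    sq_displacement n w + 2 * (w (int i + 1) - w (int i))"
proof -
  let ?s = "affine_transp n (int i) (int i + 1)"
  have ij: "\<not> [int i = int i + 1] (mod int n)" using not_cong_Suc[OF n] .
  let ?g = "\<lambda>k. (w k - ?s k)\<^sup>2 - (w k - k)\<^sup>2"
  have "sq_displacement n (w \<circ> cox_gen n i) = (\<Sum>k\<in>{0..<int n}. (w (?s k) - k)\<^sup>2)"
    by (simp add: sq_displacement_def cox_gen_def)
  \<comment> \<open>Substituting \<open>?s k\<close> for \<open>k\<close> moves the reflection off
    the argument of \<open>w\<close>; the summand then changes only in the classes of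
    \<open>i\<close> and \<open>i + 1\<close>.\<close>
  also have "\<dots> = (\<Sum>k\<in>{0..<int n}. (w (?s (?s k)) - ?s k)\<^sup>2)"
    using n w by (intro sum_periodic_reindex[symmetric])
      (auto simp: affine_transp_shift bij_is_inj bij_affine_transp[OF ij])
  also have "\<dots> = sq_displacement n w + (\<Sum>k\<in>{0..<int n}. ?g k)"
    by (simp add: affine_transp_involution[OF ij] sq_displacement_def flip: sum.distrib)
  also have "(\<Sum>k\<in>{0..<int n}. ?g k) = ?g (int i) + ?g (int i + 1)"
    using n ij w by (intro sum_periodic_two_classes)
      (auto simp: affine_transp_shift affine_transp_other)
  also have "\<dots> = 2 * (w (int i + 1) - w (int i))"
    unfolding affine_transp_left affine_transp_right[OF ij]
    by (simp add: power2_eq_square algebra_simps)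
  finally show ?thesis .
qed

text \<open>Without descents the periodic function \<open>w k - k\<close> is weakly increasing,
  hence constant, and the normalisation makes the constant 0.\<close>

lemma affine_sym_no_descent_eq_id:
  assumes n: "n > 0" and w: "w \<in> affine_sym n"
    and inc: "\<And>i. i < n \<Longrightarrow> w (int i) < w (int i + 1)"
  shows "w = id"
proof -
  define g where "g = (\<lambda>k. w k - k)"
  have w': "\<And>k. w (k + int n) = w k + int n" "(\<Sum>k\<in>{0..<int n}. g k) = 0"
    using w affine_sym_iff[OF n] by (auto simp: g_def)
  have g: "g (k + int n) = g k" for k by (simp add: g_def w')
  \<comment> \<open>Shifting the argument by one preserves the sum of \<open>g\<close> over a
    period.\<close>
  have "(\<Sum>k\<in>{0..<int n}. g (k + 1) - g k) = 0"
    using sum_periodic_reindex[of "int n" g "\<lambda>k. k + 1"] g n by (simp add: sum_subtractf)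
  moreover have "g (k + 1) - g k \<ge> 0" if "k \<in> {0..<int n}" for k
    using inc[of "nat k"] that by (simp add: g_def nat_less_iff)
  ultimately have "\<forall>k\<in>{0..<int n}. g (k + 1) - g k = 0"
    by (subst (asm) sum_nonneg_eq_0_iff) auto
  then have "g (k mod int n + 1) - g (k mod int n) = 0" for k
    using n by simp
  moreover have "g (k mod int n + 1) - g (k mod int n) = g (k + 1) - g k" for k
  proof (rule periodic_mod)
    show "g (k + int n + 1) - g (k + int n) = g (k + 1) - g k" for k
      using g[of "k + 1"] g[of k] by (simp add: algebra_simps)
  qed
  ultimately have step: "g (k + 1) = g k" for k by (metis eq_iff_diff_eq_0)
  have const: "g k = g 0" for k
    using periodic_mult[of g 1 0 k] step by simp
  have "(\<Sum>k\<in>{0..<int n}. g k) = (\<Sum>k\<in>{0..<int n}. g 0)" by (intro sum.cong refl const)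
  then have "int n * g 0 = 0" using w'(2) by simp
  then have "g k = 0" for k using const[of k] n by simp
  then show ?thesis by (auto simp: g_def)
qed

lemma cox_prod_snoc: "cox_prod n (is @ [i]) = cox_prod n is \<circ> cox_gen n i"
  by (induction "is") (auto simp: cox_prod_def)

lemma affine_sym_generated:
  assumes n: "n \<ge> 2" and w: "w \<in> affine_sym n"
  shows "\<exists>is. set is \<subseteq> {..<n} \<and> cox_prod n is = w"
  using w
proof (induction "nat (sq_displacement n w)" arbitrary: w rule: less_induct)
  case less
  have n0: "n > 0" using n by simp
  have w: "bij w" "\<And>k. w (k + int n) = w k + int n"
    using less.prems affine_sym_iff[OF n0] by auto
  show ?case
  proof (cases "\<forall>i<n. w (int i) < w (int i + 1)")
    case True
    then have "w = id" using affine_sym_no_descent_eq_id[OF n0 less.prems] by blast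
    then have "set [] \<subseteq> {..<n} \<and> cox_prod n [] = w" by (simp add: cox_prod_def)
    then show ?thesis by blast
  next
    case False
    then obtain i where i: "i < n" "w (int i + 1) \<le> w (int i)" by force
    have ij: "\<not> [int i = int i + 1] (mod int n)" using not_cong_Suc[OF n] .
    \<comment> \<open>Injectivity makes the descent strict, so the measure really drops.\<close>
    have "w (int i + 1) \<noteq> w (int i)" using w(1) by (simp add: bij_is_inj inj_eq)
    then have "sq_displacement n (w \<circ> cox_gen n i) < sq_displacement n w"
      using sq_displacement_comp_cox_gen[of n w, OF n w(2)] i(2) by simp
    moreover have "sq_displacement n (w \<circ> cox_gen n i) \<ge> 0"
      unfolding sq_displacement_def by (simp add: sum_nonneg)
    ultimately have "nat (sq_displacement n (w \<circ> cox_gen n i)) < nat (sq_displacement n w)"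
      by simp
    moreover have "w \<circ> cox_gen n i \<in> affine_sym n"
      unfolding cox_gen_def by (rule affine_sym_comp_transp[OF n0 less.prems ij])
    ultimately obtain "is" where "set is \<subseteq> {..<n}" "cox_prod n is = w \<circ> cox_gen n i"
      using less.hyps by blast
    moreover have "w \<circ> cox_gen n i \<circ> cox_gen n i = w"
      by (auto simp: cox_gen_def affine_transp_involution[OF ij])
    ultimately have "set (is @ [i]) \<subseteq> {..<n} \<and> cox_prod n (is @ [i]) = w"
      using i(1) by (simp add: cox_prod_snoc)
    then show ?thesis by blast
  qed
qed

section \<open>Displacement and the Bruhat action\<close>

lemma cox_prod_displacement: "\<bar>cox_prod n is k - k\<bar> \<le> int (length is)"
proof (induction "is")
  case Nil
  show ?case by (simp add: cox_prod_def)
next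
  case (Cons i "is")
  \<comment> \<open>The head of a word is applied last, so this is needed at the image of
    \<open>k\<close> under the tail.\<close>
  have "\<bar>cox_gen n i l - l\<bar> \<le> 1" for l
    by (simp add: cox_gen_def affine_transp_def)
  from this[of "cox_prod n is k"] Cons show ?case by (simp add: cox_prod_def)
qed

text \<open>Generation ensures that the \<open>LEAST\<close> in \<open>cox_length\<close> is
  attained, so a word of exactly that length produces \<open>w\<close>.\<close>

lemma affine_sym_displacement:
  assumes "n \<ge> 2" and "w \<in> affine_sym n"
  shows "\<bar>w k - k\<bar> \<le> int (cox_length n w)"
proof -
  have "\<exists>is. set is \<subseteq> {..<n} \<and> length is = cox_length n w \<and> cox_prod n is = w"
    unfolding cox_length_def by (rule LeastI_ex) (use affine_sym_generated[OF assms] in blast)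
  then show ?thesis using cox_prod_displacement by metis
qed

lemma bruhat_word_zero: "bruhat_word n 0 J = 0"
  by (induction J) (auto simp: bruhat_word_def)

lemma bruhat_word_Cons:
  "bruhat_word n (nil_basis w) (p # J) = bruhat_word n (bruhat_basis n p w) J"
  by (simp add: bruhat_word_def)

text \<open>The bound \<open>L\<close> replaces the exact length because each letter that acts
  nontrivially lowers the length: the same \<open>L\<close> then serves for the rest of the
  word.\<close>

lemma bruhat_word_nonzero_short:
  assumes n: "n \<ge> 2"
  shows "w \<in> affine_sym n \<Longrightarrow> cox_length n w \<le> L \<Longrightarrow> J \<in> lists (symbols n) \<Longrightarrow>
    bruhat_word n (nil_basis w) J \<noteq> 0 \<Longrightarrow> J \<in> lists (short_symbols n (2 * L + 1))"
proof (induction J arbitrary: w)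
  case Nil
  show ?case by simp
next
  case (Cons p J)
  obtain i j where p: "p = (i, j)" by fastforce
  have ij: "i < j" "\<not> [i = j] (mod int n)" using Cons.prems(3) by (auto simp: p symbols_def)
  define v where "v = w \<circ> affine_transp n i j"
  have v: "v \<in> affine_sym n"
    unfolding v_def using n by (intro affine_sym_comp_transp Cons.prems(1) ij(2)) simp
  have "bruhat_basis n p w \<noteq> 0"
    using Cons.prems(4) by (auto simp: bruhat_word_Cons bruhat_word_zero)
  then have vw: "cox_length n v + 1 = cox_length n w" "bruhat_basis n p w = nil_basis v"
    by (auto simp: bruhat_basis_def p v_def split: if_splits)
  have "J \<in> lists (short_symbols n (2 * L + 1))"
    using Cons.IH[OF v] vw Cons.prems by (simp add: bruhat_word_Cons)
  moreover have "v i = w j" by (simp add: v_def affine_transp_left)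
  \<comment> \<open>Here \<open>j - i\<close> is the difference of the displacements
    \<open>v i - i\<close> and \<open>w j - j\<close>, bounded by the lengths of \<open>v\<close>
    and \<open>w\<close>.\<close>
  then have "j - i < int (2 * L + 1)"
    using affine_sym_displacement[OF n v, of i] affine_sym_displacement[OF n Cons.prems(1), of j]
      vw(1) Cons.prems(2) by linarith
  ultimately show ?case using ij by (simp add: p short_symbols_def symbols_def)
qed

theorem theorem3p2:
  fixes n :: nat and a :: "(int \<times> int) list \<Rightarrow> int"
  assumes "n \<ge> 2"
    and "a \<in> formal_sums n"
    and "\<And>M :: nat. M > 0 \<Longrightarrow> finite {J \<in> lists (short_symbols n M). a J \<noteq> 0}"
  shows "valid_bruhat_action n a"
  unfolding valid_bruhat_action_def
proof
  fix w assume w: "w \<in> affine_sym n"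
  let ?M = "2 * cox_length n w + 1"
  have "{J \<in> lists (symbols n).
       frag_cmul (a J) (bruhat_word n (nil_basis w) J) \<noteq> \<zero>\<^bsub>nilCoxeter n\<^esub>}
      \<subseteq> {J \<in> lists (short_symbols n ?M). a J \<noteq> 0}"
    \<comment> \<open>A nonzero term forces both \<open>a J\<close> and the action of
      \<open>J\<close> on the basis element to be nonzero.\<close>
    using bruhat_word_nonzero_short[OF assms(1) w order_refl] by (auto simp: nilCoxeter_def)
  then show "finite {J \<in> lists (symbols n).
       frag_cmul (a J) (bruhat_word n (nil_basis w) J) \<noteq> \<zero>\<^bsub>nilCoxeter n\<^esub>}"
    using assms(3)[of ?M] by (rule finite_subset) simp
qed

end
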